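(* Let $s\ge 1$ be an integer and let $n=T_s=\frac{s(s+1)}2$. Then $\Delta_n=s(s-1)$, and the unique partition $\lambda\vdash n$ with $\deg(\lambda)=\Delta_n$ is the staircase partition $\delta_s=(s,s-1,\dots,1)$.
   Context: Partition graph: for $n\ge 1$, $G_n$ is the simple graph whose vertices are the integer partitions of $n$; two distinct partitions are adjacent if one is obtained from the other by an elementary transfer of one unit from one part to another (subtract $1$ from one part and add $1$ to another part), followed by reordering. Here the receiving part may be a zero part (so a new part $1$ may be created), and parts that become $0$ are discarded. $\deg(\lambda)$ is the degree of $\lambda$ in $G_n$, and $\Delta_n:=\max_{\lambda\vdash n}\deg(\lambda)$. *)

theory Defs
  imports Main "HOL-Library.Multiset"
begin

text \<open>A partition is the multiset of its (positive) parts, so that reordering is implicit.\<close>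

definition partitions :: "nat \<Rightarrow> nat multiset set" where
  "partitions n = {p. 0 \<notin># p \<and> sum_mset p = n}"

text \<open>
  One unit passes from a part \<open>a\<close> to a different part \<open>b\<close>, possibly of equal size, or to a
  zero part. When \<open>b = 0\<close>, subtracting \<open>{#b#}\<close> has no effect because \<open>0\<close> does not occur in a
  partition.
\<close>

definition transfer :: "nat multiset \<Rightarrow> nat multiset \<Rightarrow> bool" where
  "transfer p q \<longleftrightarrow>
     (\<exists>a b. a \<in># p \<and> (b \<in># p - {#a#} \<or> b = 0) \<and>
        q = filter_mset (\<lambda>x. x \<noteq> 0) (p - {#a#} - {#b#} + {#a - 1, b + 1#}))"

definition adjacent :: "nat multiset \<Rightarrow> nat multiset \<Rightarrow> bool" where
  "adjacent p q \<longleftrightarrow> p \<noteq> q \<and> (transfer p q \<or> transfer q p)"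

definition deg :: "nat \<Rightarrow> nat multiset \<Rightarrow> nat" where
  "deg n p = card {q \<in> partitions n. adjacent p q}"

definition max_deg :: "nat \<Rightarrow> nat" where
  "max_deg n = Max (deg n ` partitions n)"

definition staircase :: "nat \<Rightarrow> nat multiset" where
  "staircase s = mset_set {1..s}"

text \<open>The sets whose cardinality and maximum are taken above are finite and nonempty.\<close>

lemma size_le_sum_mset: "0 \<notin># p \<Longrightarrow> size p \<le> sum_mset p" for p :: "nat multiset"
  by (induction p) auto

lemma finite_partitions: "finite (partitions n)"
proof -
  have "partitions n \<subseteq> mset ` {xs. set xs \<subseteq> {..n} \<and> length xs \<le> n}"
  proof
    fix p assume p: "p \<in> partitions n"
    obtain xs where xs: "mset xs = p" using ex_mset by blast
    have "length xs \<le> n"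
      using p size_le_sum_mset[of p] unfolding partitions_def xs[symmetric] size_mset by simp
    moreover have "x \<le> n" if "x \<in> set xs" for x
      using p member_le_sum_list[OF that] unfolding partitions_def xs[symmetric]
      by (simp add: sum_mset_sum_list)
    then have "set xs \<subseteq> {..n}" by blast
    ultimately show "p \<in> mset ` {xs. set xs \<subseteq> {..n} \<and> length xs \<le> n}"
      using xs by blast
  qed
  then show ?thesis
    by (rule finite_subset) (intro finite_imageI finite_lists_length_le, simp)
qed

lemma partitions_nonempty: "partitions n \<noteq> {}"
proof -
  have "replicate_mset n 1 \<in> partitions n"
    by (auto simp: partitions_def)
  then show ?thesis by blast
qed

end

theory Submission
  imports Defs
begin

text \<open>
  For \<open>k \<ge> 1\<close>, moving a unit from a part \<open>a\<close> to a part \<open>b\<close> lowers the number of parts \<open>\<ge> k\<close> by one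
  at \<open>k = a\<close> and raises it by one at \<open>k = b + 1\<close>. So the moves with \<open>a \<noteq> b + 1\<close> lead to pairwise
  distinct neighbours, and the degree of \<open>p\<close> is the number of such pairs \<open>(a, b)\<close>. If \<open>p\<close> has
  \<open>d\<close> distinct part sizes, there are at most \<open>d (d + 1)\<close> pairs, and \<open>n = T\<^sub>s\<close> forces \<open>d \<le> s\<close>, with
  \<open>d = s\<close> only for the staircase. For \<open>d < s\<close> the degree is below \<open>s (s - 1)\<close>: in the only critical
  case \<open>d = s - 1\<close>, all \<open>d (d + 1)\<close> pairs being available would force every part to be repeated and
  to exceed \<open>1\<close>, which makes the sum larger than \<open>T\<^sub>s\<close>.
\<close>

section \<open>Transfers of one unit and the neighbours they produce\<close>

definition move :: "nat multiset \<Rightarrow> nat \<Rightarrow> nat \<Rightarrow> nat multiset" where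
  "move p a b = filter_mset (\<lambda>x. x \<noteq> 0) (p - {#a#} - {#b#} + {#a - 1, b + 1#})"

text \<open>Pairs of sizes, not of occurrences. The case \<open>a = Suc b\<close> is left out
  because that move only swaps the two sizes and returns \<open>p\<close>.\<close>

definition movable :: "nat multiset \<Rightarrow> (nat \<times> nat) set" where
  "movable p = {(a, b). a \<in># p \<and> (b \<in># p - {#a#} \<or> b = 0) \<and> a \<noteq> Suc b}"

lemma transfer_iff_move:
  "transfer p q \<longleftrightarrow> (\<exists>a b. a \<in># p \<and> (b \<in># p - {#a#} \<or> b = 0) \<and> q = move p a b)"
  unfolding transfer_def move_def ..

lemma filter_nonzero_id: "0 \<notin># u \<Longrightarrow> filter_mset ((<) 0) u = u" for u :: "nat multiset"
  by (induction u) auto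

text \<open>Isolates the untouched parts \<open>r\<close>. Letting the filter discard a receiving
  \<open>b = 0\<close> puts an existing and a newly created receiver in one formula.\<close>

lemma move_cases:
  assumes "0 \<notin># p" "a \<in># p" "b \<in># p - {#a#} \<or> b = 0"
  obtains r where "p = filter_mset (\<lambda>x. x \<noteq> 0) (r + {#a, b#})" "0 \<notin># r" "0 < a"
    "move p a b = filter_mset (\<lambda>x. x \<noteq> 0) (r + {#a - 1, b + 1#})"
proof -
  obtain t where t: "p = add_mset a t" using assms(2) by (metis insert_DiffM)
  have a: "0 < a" using assms(1,2) by (metis gr0I)
  have t0: "0 \<notin># t" using assms(1) t by auto
  show thesis
  proof (cases "b = 0")
    case True
    show thesis
      by (rule that[of t]) (use t t0 a True in \<open>auto simp: move_def filter_nonzero_id diff_single_trivial\<close>)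
  next
    case False
    then have "b \<in># t" using assms(3) t by auto
    then obtain r where r: "t = add_mset b r" by (metis insert_DiffM)
    show thesis
      by (rule that[of r]) (use t r t0 a False in \<open>auto simp: move_def filter_nonzero_id\<close>)
  qed
qed

text \<open>These counts are the parts of the conjugate partition. With \<open>1 \<le> k\<close>,
  discarding zeros does not affect them.\<close>

lemma size_ge_move:
  assumes "0 \<notin># p" "a \<in># p" "b \<in># p - {#a#} \<or> b = 0" "1 \<le> k"
  shows "int (size (filter_mset (\<lambda>x. k \<le> x) (move p a b))) =
         int (size (filter_mset (\<lambda>x. k \<le> x) p)) - of_bool (k = a) + of_bool (k = Suc b)"
proof -
  obtain r where r: "p = filter_mset (\<lambda>x. x \<noteq> 0) (r + {#a, b#})" "0 < a"
    "move p a b = filter_mset (\<lambda>x. x \<noteq> 0) (r + {#a - 1, b + 1#})"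
    using move_cases[OF assms(1-3)] by metis
  have *: "filter_mset (\<lambda>x. k \<le> x) (filter_mset (\<lambda>x. x \<noteq> 0) u) = filter_mset (\<lambda>x. k \<le> x) u" for u
    unfolding filter_filter_mset by (rule filter_mset_cong) (use assms(4) in auto)
  show ?thesis
    unfolding r(3) arg_cong[OF r(1), of "filter_mset (\<lambda>x. k \<le> x)"] *
    using assms(4) r(2) by auto
qed

lemma move_neq:
  assumes "0 \<notin># p" "(a, b) \<in> movable p"
  shows "move p a b \<noteq> p"
proof
  assume "move p a b = p"
  then show False
    using size_ge_move[of p a b "Suc b"] assms by (auto simp: movable_def)
qed

lemma inj_on_move:
  assumes "0 \<notin># p"
  shows "inj_on (\<lambda>(a, b). move p a b) (movable p)"
proof (rule inj_onI, clarify)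
  fix a b c d
  assume ab: "(a, b) \<in> movable p" and cd: "(c, d) \<in> movable p" and eq: "move p a b = move p c d"
  have ab': "a \<in># p" "b \<in># p - {#a#} \<or> b = 0" "a \<noteq> Suc b"
    and cd': "c \<in># p" "d \<in># p - {#c#} \<or> d = 0" "c \<noteq> Suc d"
    using ab cd by (auto simp: movable_def)
  \<comment> \<open>As \<open>a\<close> and \<open>Suc b\<close> differ, the change takes the value
    -1 only at \<open>a\<close> and 1 only at \<open>Suc b\<close>, so it determines the pair;
    likewise for \<open>c\<close> and \<open>d\<close>.\<close>
  have *: "- of_bool (k = a) + of_bool (k = Suc b) = - of_bool (k = c) + (of_bool (k = Suc d) :: int)"
    if "1 \<le> k" for k
    using size_ge_move[OF assms ab'(1,2) that] size_ge_move[OF assms cd'(1,2) that] eq by simp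
  have "1 \<le> a" using ab'(1) assms by (metis One_nat_def Suc_leI gr0I)
  then have "a = c" using *[of a] ab'(3) by (cases "a = c") (auto simp: of_bool_def split: if_splits)
  moreover have "b = d" using *[of "Suc b"] ab'(3) by (auto simp: of_bool_def split: if_splits)
  ultimately show "a = c \<and> b = d" ..
qed

lemma sum_mset_nonzero: "sum_mset (filter_mset (\<lambda>x. x \<noteq> 0) u) = sum_mset u"
  for u :: "nat multiset"
  by (induction u) auto

lemma move_in_partitions:
  assumes "p \<in> partitions n" "a \<in># p" "b \<in># p - {#a#} \<or> b = 0"
  shows "move p a b \<in> partitions n"
proof -
  have p: "0 \<notin># p" "sum_mset p = n" using assms(1) by (auto simp: partitions_def)
  obtain r where r: "p = filter_mset (\<lambda>x. x \<noteq> 0) (r + {#a, b#})" "0 < a"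
    "move p a b = filter_mset (\<lambda>x. x \<noteq> 0) (r + {#a - 1, b + 1#})"
    using move_cases[OF p(1) assms(2,3)] by metis
  have "sum_mset (move p a b) = sum_mset p"
    unfolding r(3) arg_cong[OF r(1), of sum_mset] sum_mset_nonzero using r(2) by simp
  moreover have "0 \<notin># move p a b" unfolding move_def set_mset_filter by blast
  ultimately show ?thesis using p by (simp add: partitions_def)
qed

text \<open>The unit travels back from \<open>b + 1\<close> to \<open>a - 1\<close>. If
  \<open>a = 1\<close>, the discarded part is recreated from a zero part.\<close>

lemma transfer_sym:
  assumes "0 \<notin># p" "transfer p q"
  shows "transfer q p"
proof -
  obtain a b where ab: "a \<in># p" "b \<in># p - {#a#} \<or> b = 0" "q = move p a b"
    using assms(2) unfolding transfer_iff_move by blast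
  obtain r where r: "p = filter_mset (\<lambda>x. x \<noteq> 0) (r + {#a, b#})" "0 \<notin># r" "0 < a"
    "q = filter_mset (\<lambda>x. x \<noteq> 0) (r + {#a - 1, b + 1#})"
    using move_cases[OF assms(1) ab(1,2)] ab(3) by metis
  have "b + 1 \<in># q" using r(4) by simp
  moreover have "a - 1 \<in># q - {#b + 1#} \<or> a - 1 = 0" using r(3,4) by auto
  moreover have "p = move q (b + 1) (a - 1)"
    unfolding r(1,4) move_def using r(2,3) filter_nonzero_id[OF r(2)] by (cases "a = 1") (auto simp: diff_single_trivial)
  ultimately show ?thesis unfolding transfer_iff_move by blast
qed

lemma deg_eq_card_movable:
  assumes "p \<in> partitions n"
  shows "deg n p = card (movable p)"
proof -
  have p: "0 \<notin># p" using assms by (simp add: partitions_def)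
  have "{q \<in> partitions n. adjacent p q} = (\<lambda>(a, b). move p a b) ` movable p" (is "?L = ?R")
  proof
    show "?L \<subseteq> ?R"
    proof
      fix q assume q: "q \<in> ?L"
      then have "0 \<notin># q" "p \<noteq> q" "transfer p q \<or> transfer q p"
        by (auto simp: partitions_def adjacent_def)
      then have "transfer p q" using transfer_sym by blast
      then obtain a b where ab: "a \<in># p" "b \<in># p - {#a#} \<or> b = 0" "q = move p a b"
        unfolding transfer_iff_move by blast
      have "a \<noteq> Suc b"
      proof
        assume a: "a = Suc b"
        obtain r where "p = filter_mset (\<lambda>x. x \<noteq> 0) (r + {#a, b#})"
          "move p a b = filter_mset (\<lambda>x. x \<noteq> 0) (r + {#a - 1, b + 1#})"
          using move_cases[OF p ab(1,2)] by metis
        then have "move p a b = p" using a by (simp add: add_mset_commute)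
        then show False using ab(3) \<open>p \<noteq> q\<close> by simp
      qed
      then show "q \<in> ?R" using ab by (auto simp: movable_def)
    qed
    show "?R \<subseteq> ?L"
    proof clarify
      fix a b assume ab: "(a, b) \<in> movable p"
      then have ab': "a \<in># p" "b \<in># p - {#a#} \<or> b = 0" by (auto simp: movable_def)
      then have "transfer p (move p a b)" unfolding transfer_iff_move by blast
      then show "move p a b \<in> partitions n \<and> adjacent p (move p a b)"
        using move_in_partitions[OF assms ab'] move_neq[OF p ab] by (auto simp: adjacent_def)
    qed
  qed
  then show ?thesis using card_image[OF inj_on_move[OF p]] by (simp add: deg_def)
qed

section \<open>Upper bound on the degree by the number of distinct part sizes\<close>

lemma sum_set_ge_triangular:
  fixes D :: "nat set"
  assumes "finite D" "0 \<notin> D"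
  shows "card D * (card D + 1) \<le> 2 * \<Sum>D \<and>
         (2 * \<Sum>D = card D * (card D + 1) \<longrightarrow> D = {1..card D})"
  using assms
proof (induction D rule: finite_linorder_max_induct)
  case empty
  then show ?case by simp
next
  case (insert m D)
  let ?d = "card D"
  have "m \<notin> D" using insert.hyps(2) by blast
  then have card: "card (insert m D) = Suc ?d" and sum: "\<Sum>(insert m D) = m + \<Sum>D"
    using insert.hyps(1) by auto
  have IH: "?d * (?d + 1) \<le> 2 * \<Sum>D" "2 * \<Sum>D = ?d * (?d + 1) \<longrightarrow> D = {1..?d}"
    using insert.IH insert.prems by auto
  \<comment> \<open>The new maximum \<open>m\<close> lies above \<open>card D\<close> distinct
    positive numbers, hence is at least \<open>card D + 1\<close>. Equality of the sums forces
    equality here.\<close>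
  have "D \<subseteq> {1..<m}"
    using insert.hyps(2) insert.prems by (auto simp: Suc_le_eq intro: gr0I)
  then have "?d \<le> m - 1" using card_mono[of "{1..<m}" D] by simp
  moreover have "0 < m" using insert.prems by auto
  ultimately have m: "Suc ?d \<le> m" by simp
  show ?case
    unfolding card sum
  proof (intro conjI impI)
    show "Suc ?d * (Suc ?d + 1) \<le> 2 * (m + \<Sum>D)" using IH(1) m by simp
    assume "2 * (m + \<Sum>D) = Suc ?d * (Suc ?d + 1)"
    then have eq: "2 * m + 2 * \<Sum>D = ?d * (?d + 1) + 2 * Suc ?d" by simp
    then have "2 * m + ?d * (?d + 1) \<le> ?d * (?d + 1) + 2 * Suc ?d"
      using add_left_mono[OF IH(1), of "2 * m"] by simp
    then have "m \<le> Suc ?d" by simp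
    then have "m = Suc ?d" using m by simp
    moreover from this have "2 * \<Sum>D = ?d * (?d + 1)" using eq by simp
    ultimately have "m = Suc ?d" "D = {1..?d}" using IH(2) by auto
    then show "insert m D = {1..Suc ?d}" by (metis atLeastAtMostSuc_conv le_add1 plus_1_eq_Suc)
  qed
qed

text \<open>One copy of each size is split off; \<open>r\<close> holds the surplus copies.\<close>

lemma sum_mset_eq_sum_set_plus:
  fixes p :: "nat multiset"
  obtains r where "p = mset_set (set_mset p) + r" "sum_mset p = \<Sum>(set_mset p) + sum_mset r"
proof -
  obtain r where r: "p = mset_set (set_mset p) + r"
    using mset_set_set_mset_msubset[of p] by (metis subset_mset.le_iff_add)
  have "sum_mset p = \<Sum>(set_mset p) + sum_mset r"
    using arg_cong[OF r, of sum_mset] by (simp add: sum_unfold_sum_mset)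
  then show thesis using r that by blast
qed

lemma movable_subset: "movable p \<subseteq> set_mset p \<times> insert 0 (set_mset p)"
  by (auto simp: movable_def dest: in_diffD)

lemma sum_ge_if_all_movable:
  assumes p: "0 \<notin># p"
    and all: "movable p = set_mset p \<times> insert 0 (set_mset p)"
  shows "(card (set_mset p) + 1) * (card (set_mset p) + 2) \<le> sum_mset p + 2"
proof -
  let ?D = "set_mset p"
  have rep: "a \<in># p - {#a#}" if "a \<in># p" for a
  proof -
    \<comment> \<open>A part can pass a unit to an equal part only if its size is repeated.\<close>
    have "(a, a) \<in> movable p" using that unfolding all by simp
    then show ?thesis using p that by (auto simp: movable_def)
  qed
  have one: "1 \<notin># p"
  proof
    assume "1 \<in># p"
    then have "(1, 0) \<in> movable p" unfolding all by simp
    then show False by (simp add: movable_def)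
  qed
  have "mset_set ?D + mset_set ?D \<subseteq># p"
  proof (rule mset_subset_eqI)
    fix a
    show "count (mset_set ?D + mset_set ?D) a \<le> count p a"
      using rep[of a] by (cases "a \<in># p") (auto simp: count_greater_zero_iff[symmetric] simp del: count_greater_zero_iff)
  qed
  then obtain r where "p = mset_set ?D + mset_set ?D + r"
    by (metis subset_mset.le_iff_add)
  from arg_cong[OF this, of sum_mset] have "2 * \<Sum>?D \<le> sum_mset p"
    by (simp add: sum_unfold_sum_mset)
  \<comment> \<open>Since 1 is not a part, adjoining it gives one more distinct size. Its
    contribution to the doubled sum is the 2 in the conclusion.\<close>
  moreover have "card (insert 1 ?D) * (card (insert 1 ?D) + 1) \<le> 2 * \<Sum>(insert 1 ?D)"
    using sum_set_ge_triangular[of "insert 1 ?D"] p by simp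
  ultimately show ?thesis using one by simp
qed

lemma card_movable_less:
  assumes p: "p \<in> partitions n" and n: "2 * n = s * (s + 1)" "0 < s"
    and less: "card (set_mset p) < s"
  shows "card (movable p) < s * (s - 1)"
proof -
  let ?D = "set_mset p" and ?d = "card (set_mset p)"
  let ?F = "set_mset p \<times> insert 0 (set_mset p)"
  have p0: "0 \<notin># p" and sum: "sum_mset p = n" using p by (auto simp: partitions_def)
  have card: "card ?F = ?d * (?d + 1)" using p0 by (simp add: card_cartesian_product)
  have mono: "k * (k + 1) \<le> s * (s - 1)" if "k < s" for k
    using mult_le_mono[of "k + 1" s k "s - 1"] that by (simp add: mult.commute)
  show ?thesis
  proof (cases "movable p = ?F")
    case False
    then have "movable p \<subset> ?F" using movable_subset by blast
    then have "card (movable p) < card ?F" by (intro psubset_card_mono) auto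
    then show ?thesis using card mono[OF less] by linarith
  next
    case True
    have "0 < n" using n by (metis add_gr_0 mult_is_0 nat_less_le not_gr_zero zero_less_one)
    then have "p \<noteq> {#}" using sum by auto
    then have d: "1 \<le> ?d" by (simp add: Suc_le_eq card_gt_0_iff)
    have "?d + 1 \<noteq> s"
    proof
      assume s: "?d + 1 = s"
      \<comment> \<open>The bound reads \<open>s * (s + 1) \<le> n + 2\<close>; doubling and
        inserting \<open>2 * n\<close> leaves \<open>s * (s + 1) \<le> 4\<close>, impossible for
        \<open>s\<close> at least 2.\<close>
      have "2 * (s * (s + 1)) \<le> s * (s + 1) + 4"
        using sum_ge_if_all_movable[OF p0 True] n(1) s[symmetric] sum by simp
      moreover have "2 * 3 \<le> s * (s + 1)"
        using d s by (intro mult_le_mono) auto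
      ultimately show False by simp
    qed
    then have "?d + 1 < s" using less by simp
    from mono[OF this] have "(?d + 1) * (?d + 2) \<le> s * (s - 1)" by simp
    moreover have "?d * (?d + 1) < (?d + 1) * (?d + 2)" by simp
    ultimately show ?thesis using True card by simp
  qed
qed

lemma partition_eq_staircase:
  assumes p: "p \<in> partitions n" and n: "2 * n = s * (s + 1)" and ge: "s \<le> card (set_mset p)"
  shows "p = staircase s"
proof -
  let ?D = "set_mset p"
  have p0: "0 \<notin># p" and sum: "sum_mset p = n" using p by (auto simp: partitions_def)
  obtain r where r: "p = mset_set ?D + r" "sum_mset p = \<Sum>?D + sum_mset r"
    by (rule sum_mset_eq_sum_set_plus)
  have T: "card ?D * (card ?D + 1) \<le> 2 * \<Sum>?D"
    "2 * \<Sum>?D = card ?D * (card ?D + 1) \<Longrightarrow> ?D = {1..card ?D}"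
    using sum_set_ge_triangular[of ?D] p0 by auto
  \<comment> \<open>Twice the sum of the sizes is squeezed between this and \<open>2 * n\<close>, so
    all the inequalities are equalities and no surplus remains.\<close>
  have "s * (s + 1) \<le> card ?D * (card ?D + 1)" using ge by (intro mult_le_mono) auto
  then have eq: "2 * \<Sum>?D = card ?D * (card ?D + 1)" "card ?D * (card ?D + 1) = s * (s + 1)"
    and r0: "sum_mset r = 0"
    using T(1) r(2) sum n by linarith+
  have "card ?D = s"
  proof (rule ccontr)
    assume "card ?D \<noteq> s"
    then have "s + 1 \<le> card ?D" using ge by simp
    then have "(s + 1) * (s + 2) \<le> card ?D * (card ?D + 1)" by (intro mult_le_mono) auto
    then show False using eq(2) by simp
  qed
  moreover have "0 \<notin># r"
  proof
    assume "0 \<in># r"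
    then have "0 \<in># mset_set ?D + r" by simp
    then show False using p0 r(1) by simp
  qed
  then have "r = {#}" using r0 size_le_sum_mset[of r] by (metis le_zero_eq size_eq_0_iff_empty)
  ultimately show ?thesis using T(2)[OF eq(1)] r(1) by (metis add.right_neutral staircase_def)
qed

section \<open>Degree of the staircase and conclusion\<close>

lemma card_movable_staircase: "card (movable (staircase s)) = s * (s - 1)"
proof -
  have mem: "b \<in># staircase s - {#a#} \<longleftrightarrow> b \<in> {1..s} - {a}" for a b
  proof -
    have "staircase s - {#a#} = mset_set ({1..s} - {a})"
      by (cases "a \<in> {1..s}") (auto simp: staircase_def mset_set_Diff diff_single_trivial)
    then show ?thesis by simp
  qed
  \<comment> \<open>Each size occurs once, so \<open>a\<close> cannot receive its own unit, and
    \<open>a - 1\<close> is the excluded trivial move. Of the \<open>s + 1\<close> candidates, zero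
    included, \<open>s - 1\<close> remain.\<close>
  have "movable (staircase s) = Sigma {1..s} (\<lambda>a. {0..s} - {a, a - 1})"
    unfolding movable_def mem by (auto simp: staircase_def)
  also have "card \<dots> = (\<Sum>a = 1..s. card ({0..s} - {a, a - 1}))" by simp
  also have "\<dots> = (\<Sum>a = 1..s. s - 1)"
  proof (rule sum.cong[OF refl])
    fix a assume "a \<in> {1..s}"
    then show "card ({0..s} - {a, a - 1}) = s - 1" by (subst card_Diff_subset) auto
  qed
  finally show ?thesis by simp
qed

theorem proposition3p1:
  fixes s n :: nat
  assumes "s \<ge> 1" and "n = s * (s + 1) div 2"
  shows "max_deg n = s * (s - 1) \<and>
         {p \<in> partitions n. deg n p = max_deg n} = {staircase s}"
proof -
  have n: "2 * n = s * (s + 1)" using assms(2) by simp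
  have "sum_mset (staircase s) = \<Sum>{1..s}" by (simp add: staircase_def sum_unfold_sum_mset)
  also have "\<dots> = n" using assms(2) by (simp add: Sum_Icc_nat)
  finally have st: "staircase s \<in> partitions n" by (simp add: partitions_def staircase_def)
  have deg_st: "deg n (staircase s) = s * (s - 1)"
    using deg_eq_card_movable[OF st] card_movable_staircase by simp
  \<comment> \<open>A partition other than the staircase has fewer than \<open>s\<close> distinct
    sizes. Strictness here gives both the maximum and its uniqueness.\<close>
  have less: "deg n p < s * (s - 1)" if "p \<in> partitions n" "p \<noteq> staircase s" for p
    using partition_eq_staircase[OF that(1) n] card_movable_less[OF that(1) n] that assms(1)
      deg_eq_card_movable[OF that(1)] by (metis leI less_eq_Suc_le One_nat_def)
  have max: "max_deg n = s * (s - 1)"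
    unfolding max_deg_def
  proof (rule Max_eqI)
    show "finite (deg n ` partitions n)" using finite_partitions by simp
    show "s * (s - 1) \<in> deg n ` partitions n" using st deg_st by (metis imageI)
    show "y \<le> s * (s - 1)" if "y \<in> deg n ` partitions n" for y
      using that less deg_st by (metis imageE less_imp_le order_refl)
  qed
  moreover have "{p \<in> partitions n. deg n p = s * (s - 1)} = {staircase s}"
    using st deg_st less by fastforce
  ultimately show ?thesis by simp
qed

end
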